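(* Let $f:[0,\infty)\to[0,\infty)$, $K>0$, $M\ge1$ and $c$ satisfy Assumptions A and B, and let $\{\xi_n\}$ satisfy Assumption N with $\nu=1$ (all stated in the context). Let $\alpha\in\left(1-\frac1M,1\right)$, let $\gamma=\max\{\alpha,1-\alpha\}$, and let $l>0$ satisfy $$l<(1-\gamma)(K-c).$$ Let $\{x_n\}_{n\in\mathbb{N}_0}$ be any solution of $$x_{n+1}=\max\left\{f(x_n)-\alpha(f(x_n)-x_n)+l\xi_{n+1},\,0\right\},\qquad n\in\mathbb{N}_0,$$ with $x_0>0$. Then for any $\varepsilon>0$, $$\mathbb P\left[\text{there exists }\mathcal N_0<\infty\text{ such that }x_n\in\left(K-\frac{l}{1-\gamma}-\varepsilon,\ K+\frac{l}{1-\gamma}+\varepsilon\right)\text{ for all }n\ge\mathcal N_0\right]=1.$$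
   Context: $\mathbb{N}_0=\{0,1,2,\dots\}$. Assumption A: $f:[0,\infty)\to[0,\infty)$ is a continuous function, $f(x)>0$ for $x>0$, $f(x)>x$ for $x\in(0,K)$, $f(x)<x$ for $x>K$, and $M\ge1$ is a constant such that $|f(x)-K|\le M|x-K|$ for all $x\ge 0$. (Hence $K>0$ is the unique positive fixed point of $f$.) Assumption B: there is a point $c\in[0,K)$ such that $f$ is strictly decreasing on $[c,\infty)$. Probabilistic setting: $(\Omega,\mathcal F,\{\mathcal F_n\},\mathbb P)$ is a complete filtered probability space whose filtration is the one generated by the sequence $\{\xi_n\}$, and $x_0$ is a deterministic initial value. The integer $\mathcal N_0$ may depend on $\omega\in\Omega$. Assumption N (with parameter $\nu\ge1$): $\{\xi_n\}$ is a sequence of independent identically distributed continuous random variables with common density function $\phi$ whose support is the interval $[-1,\nu]$; $\xi_n(\omega)\in[-1,\nu]$ for all $n$ and all $\omega\in\Omega$, and every nondegenerate subinterval of $[-1,\nu]$ has positive probability under the law of $\xi_n$. *)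

theory Defs
  imports "HOL-Probability.Probability"
begin

text \<open>Functions on the half-line \<open>[0,\<infinity>)\<close> are represented by functions on \<open>real\<close>
  whose values at negative arguments are left unconstrained.\<close>

definition assumption_A :: "(real \<Rightarrow> real) \<Rightarrow> real \<Rightarrow> real \<Rightarrow> bool" where
  "assumption_A f K M \<longleftrightarrow>
     continuous_on {0..} f \<and>
     (\<forall>x\<ge>0. f x \<ge> 0) \<and>
     (\<forall>x>0. f x > 0) \<and>
     (\<forall>x\<in>{0<..<K}. f x > x) \<and>
     (\<forall>x>K. f x < x) \<and>
     M \<ge> 1 \<and>
     (\<forall>x\<ge>0. \<bar>f x - K\<bar> \<le> M * \<bar>x - K\<bar>)"

definition assumption_B :: "(real \<Rightarrow> real) \<Rightarrow> real \<Rightarrow> real \<Rightarrow> bool" where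
  "assumption_B f K c \<longleftrightarrow> 0 \<le> c \<and> c < K \<and> strict_antimono_on {c..} f"

definition generated_filtration ::
    "'a measure \<Rightarrow> (nat \<Rightarrow> 'a \<Rightarrow> real) \<Rightarrow> nat \<Rightarrow> 'a measure" where
  "generated_filtration P \<xi> n =
     sigma (space P) (\<Union>i\<in>{1..n}. {\<xi> i -` B \<inter> space P | B. B \<in> sets borel})"

text \<open>The noise sequence is \<open>\<xi> 1, \<xi> 2, \<dots>\<close>; the junk value \<open>\<xi> 0\<close> is unconstrained.\<close>

locale assumption_N = prob_space P + complete_measure P
  for P :: "'a measure" +
  fixes F :: "nat \<Rightarrow> 'a measure"
    and \<xi> :: "nat \<Rightarrow> 'a \<Rightarrow> real"
    and \<phi> :: "real \<Rightarrow> real"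
    and \<nu> :: real
  assumes nu_ge_1: "\<nu> \<ge> 1"
    and filtration_generated: "F = generated_filtration P \<xi>"
    and indep: "indep_vars (\<lambda>_. borel) \<xi> {1..}"
    and density_nonneg: "\<And>t. \<phi> t \<ge> 0"
    and common_density: "\<And>n. n \<ge> 1 \<Longrightarrow> distributed P lborel (\<xi> n) (\<lambda>t. ennreal (\<phi> t))"
    and density_support: "closure {t. \<phi> t \<noteq> 0} = {-1..\<nu>}"
    and range: "\<And>n \<omega>. n \<ge> 1 \<Longrightarrow> \<omega> \<in> space P \<Longrightarrow> \<xi> n \<omega> \<in> {-1..\<nu>}"
    and interval_pos: "\<And>n I. n \<ge> 1 \<Longrightarrow> is_interval I \<Longrightarrow> I \<subseteq> {-1..\<nu>} \<Longrightarrow>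
           (\<exists>a\<in>I. \<exists>b\<in>I. a < b) \<Longrightarrow> measure (distr P borel (\<xi> n)) I > 0"

end

theory Submission
  imports Defs
begin

text \<open>
  Write \<open>g x = f x - \<alpha> * (f x - x)\<close> for the controlled map, a convex combination of \<open>f x\<close> and
  \<open>x\<close>, and follow the distance \<open>\<bar>x n - K\<bar>\<close>.

  For \<open>x \<ge> c\<close>, monotonicity puts \<open>f x\<close> on the side of \<open>K\<close> opposite to \<open>x\<close>. The two terms of
  \<open>g x - K = (1 - \<alpha>) * (f x - K) + \<alpha> * (x - K)\<close> thus have opposite signs. As \<open>(1 - \<alpha>) * M < 1\<close>,
  this gives \<open>\<bar>g x - K\<bar> \<le> \<gamma> * \<bar>x - K\<bar>\<close> with the factor \<open>\<gamma> = max \<alpha> (1 - \<alpha>)\<close>, whatever the size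
  of \<open>M\<close>. Since \<open>\<gamma> * (K - c) + l < K - c\<close>, the ball of radius \<open>K - c\<close> about \<open>K\<close> is a trap: noise
  of size at most \<open>l\<close> cannot throw the orbit out of it, and inside it the distance to \<open>K\<close> obeys
  \<open>d (n + 1) \<le> \<gamma> * d n + l\<close>. Hence the distance eventually is below
  \<open>l / (1 - \<gamma>) + \<epsilon>\<close>, pathwise (lemma \<open>eventually_near_if_trapped\<close>).

  It remains to see that almost every orbit reaches the trap. The only difficulty is
  the region \<open>x < c\<close>, where \<open>g\<close> need not contract (if \<open>f 0 = 0\<close>, then \<open>0\<close> is fixed by \<open>g\<close>).
  There, however, \<open>g x \<ge> x\<close>, so noise \<open>\<ge> 1/2\<close> moves the orbit up by \<open>l/2\<close>, and an overshoot
  past \<open>K\<close> is no farther from \<open>K\<close> than \<open>(1 - \<alpha>) * (K - x) + l\<close>. Altogether, outside the trap a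
  noise value \<open>\<ge> 1/2\<close> brings the orbit closer to \<open>K\<close> by at least a fixed amount \<open>\<eta> > 0\<close>. The
  distance never exceeds \<open>max \<bar>x0 - K\<bar> K\<close>, so a fixed number \<open>N\<close> of consecutive noise values
  \<open>\<ge> 1/2\<close>, occurring at any time, forces the orbit into the trap (lemma \<open>trapped_after_run\<close>).
  Independence makes such a run of length \<open>N\<close> occur almost surely (lemma \<open>AE_run_in_set\<close>).
\<close>

section \<open>One step of the perturbed map\<close>

locale perturbed_map =
  fixes f :: "real \<Rightarrow> real" and K M c \<alpha> \<gamma> l :: real
  assumes A: "assumption_A f K M"
    and B: "assumption_B f K c"
    and alpha: "\<alpha> \<in> {1 - 1 / M <..< 1}"
    and gamma: "\<gamma> = max \<alpha> (1 - \<alpha>)"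
    and l_pos: "l > 0"
    and l_less: "l < (1 - \<gamma>) * (K - c)"
begin

definition control :: "real \<Rightarrow> real" where
  "control x = f x - \<alpha> * (f x - x)"

definition step :: "real \<Rightarrow> real \<Rightarrow> real" where
  "step x w = max (control x + l * w) 0"

text \<open>The least decrease of the distance to \<open>K\<close> under a step from outside the trap with noise
  \<open>\<ge> 1/2\<close>: the first term comes from contraction, the second from the push by the noise.\<close>

definition \<eta> :: real where
  "\<eta> = min ((1 - \<gamma>) * (K - c) - l) (l / 2)"

lemma M_ge_1: "M \<ge> 1"
  using A by (simp add: assumption_A_def)

lemma c_bounds: "0 \<le> c" "c < K"
  using B by (auto simp: assumption_B_def)

lemma alpha_M_less_1: "(1 - \<alpha>) * M < 1"
proof -
  have "1 - \<alpha> < 1 / M" using alpha by auto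
  then show ?thesis using M_ge_1 by (simp add: pos_less_divide_eq)
qed

lemma alpha_bounds: "0 < \<alpha>" "\<alpha> < 1"
proof -
  have "1 / M \<le> 1" using M_ge_1 by simp
  then show "0 < \<alpha>" "\<alpha> < 1" using alpha by auto
qed

lemma gamma_bounds: "0 < \<gamma>" "\<gamma> < 1" "\<alpha> \<le> \<gamma>" "1 - \<alpha> \<le> \<gamma>"
  using gamma alpha_bounds by auto

lemma eta_pos: "\<eta> > 0"
  using l_pos l_less by (simp add: \<eta>_def)

lemma control_minus_K: "control x - K = (1 - \<alpha>) * (f x - K) + \<alpha> * (x - K)"
  by (simp add: control_def algebra_simps)

lemma f_dist_le: "x \<ge> 0 \<Longrightarrow> \<bar>f x - K\<bar> \<le> M * \<bar>x - K\<bar>"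
  using A by (simp add: assumption_A_def)

lemma f_dist_scaled: "x \<ge> 0 \<Longrightarrow> (1 - \<alpha>) * \<bar>f x - K\<bar> \<le> \<bar>x - K\<bar>"
proof -
  assume "x \<ge> 0"
  then have "(1 - \<alpha>) * \<bar>f x - K\<bar> \<le> (1 - \<alpha>) * (M * \<bar>x - K\<bar>)"
    using f_dist_le alpha_bounds by (intro mult_left_mono) auto
  also have "\<dots> = ((1 - \<alpha>) * M) * \<bar>x - K\<bar>" by simp
  also have "\<dots> \<le> 1 * \<bar>x - K\<bar>"
    using alpha_M_less_1 by (intro mult_right_mono) auto
  finally show ?thesis by simp
qed

lemma f_K: "f K = K"
  using f_dist_le[of K] c_bounds by simp

text \<open>The two terms of \<open>control_minus_K\<close> have opposite signs here. On the side of \<open>x\<close> the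
  distance is thus at most \<open>\<alpha> * \<bar>x - K\<bar>\<close>; on the other side, \<open>\<alpha> * \<bar>x - K\<bar>\<close> is subtracted from
  \<open>(1 - \<alpha>) * \<bar>f x - K\<bar> \<le> \<bar>x - K\<bar>\<close>, which leaves at most \<open>(1 - \<alpha>) * \<bar>x - K\<bar>\<close>.\<close>

lemma control_contracts:
  assumes "x \<ge> c"
  shows "\<bar>control x - K\<bar> \<le> \<gamma> * \<bar>x - K\<bar>"
proof -
  have "x \<ge> 0" using assms c_bounds by simp
  note scaled = f_dist_scaled[OF this]
  have anti: "strict_antimono_on {c..} f" using B by (simp add: assumption_B_def)
  have le1: "\<alpha> * \<bar>x - K\<bar> \<le> \<gamma> * \<bar>x - K\<bar>" and le2: "(1 - \<alpha>) * \<bar>x - K\<bar> \<le> \<gamma> * \<bar>x - K\<bar>"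
    using gamma_bounds by (auto intro: mult_right_mono)
  consider "x = K" | "x > K" | "x < K" by linarith
  then show ?thesis
  proof cases
    case 1
    then show ?thesis using control_minus_K[of x] f_K by simp
  next
    case 2
    then have "f x < f K"
      using monotone_onD[OF anti, of K x] c_bounds by simp
    then have "f x - K < 0" using f_K by simp
    moreover from this have "(1 - \<alpha>) * (f x - K) \<le> 0"
      using alpha_bounds by (simp add: mult_le_0_iff)
    ultimately show ?thesis
      using 2 scaled le1 le2 control_minus_K[of x] by (simp add: abs_if algebra_simps)
  next
    case 3
    then have "f K < f x"
      using monotone_onD[OF anti, of x K] assms c_bounds by simp
    then have "f x - K > 0" using f_K by simp
    moreover from this have "(1 - \<alpha>) * (f x - K) \<ge> 0"
      using alpha_bounds by simp
    ultimately show ?thesis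
      using 3 scaled le1 le2 control_minus_K[of x] by (simp add: abs_if algebra_simps)
  qed
qed

lemma control_left:
  assumes "0 \<le> x" "x < c"
  shows "x \<le> control x" and "control x - K \<le> \<gamma> * (K - x)"
proof -
  have "f x \<ge> x"
  proof (cases "x = 0")
    case True
    then show ?thesis using A by (simp add: assumption_A_def)
  next
    case False
    then have "x \<in> {0<..<K}" using assms c_bounds by auto
    then have "f x > x" using A unfolding assumption_A_def by blast
    then show ?thesis by simp
  qed
  then have "(1 - \<alpha>) * (f x - x) \<ge> 0" using alpha_bounds by simp
  then show "x \<le> control x" by (simp add: control_def algebra_simps)
  have "(1 - \<alpha>) * (f x - K) \<le> (1 - \<alpha>) * \<bar>f x - K\<bar>"
    using alpha_bounds by (intro mult_left_mono) auto
  also have "\<dots> \<le> K - x" using f_dist_scaled[of x] assms c_bounds by simp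
  finally have "control x - K \<le> (1 - \<alpha>) * (K - x)"
    using control_minus_K[of x] by (simp add: algebra_simps)
  also have "\<dots> \<le> \<gamma> * (K - x)"
    using gamma_bounds assms c_bounds by (intro mult_right_mono) auto
  finally show "control x - K \<le> \<gamma> * (K - x)" .
qed

text \<open>Truncation at \<open>0 < K\<close> only brings the value closer to \<open>K\<close>.\<close>

lemma step_dist_le: "\<bar>step x w - K\<bar> \<le> \<bar>control x + l * w - K\<bar>"
  using c_bounds by (simp add: step_def)

lemma step_nonneg: "step x w \<ge> 0"
  by (simp add: step_def)

lemma noise_le: "\<bar>w\<bar> \<le> 1 \<Longrightarrow> \<bar>l * w\<bar> \<le> l"
  using l_pos by (simp add: abs_mult mult_left_le)

lemma step_contracts:
  assumes "x \<ge> c" "\<bar>w\<bar> \<le> 1"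
  shows "\<bar>step x w - K\<bar> \<le> \<gamma> * \<bar>x - K\<bar> + l"
  using step_dist_le[of x w] control_contracts[OF assms(1)] noise_le[OF assms(2)] by linarith

lemma step_stays_trapped:
  assumes "\<bar>x - K\<bar> \<le> K - c" "\<bar>w\<bar> \<le> 1"
  shows "\<bar>step x w - K\<bar> \<le> K - c"
proof -
  have "\<bar>step x w - K\<bar> \<le> \<gamma> * \<bar>x - K\<bar> + l"
    using assms by (intro step_contracts) auto
  also have "\<gamma> * \<bar>x - K\<bar> \<le> \<gamma> * (K - c)"
    using assms gamma_bounds by (intro mult_left_mono) auto
  finally show ?thesis using l_less by (simp add: algebra_simps)
qed

text \<open>At distance at least \<open>K - c\<close> from \<open>K\<close>, contraction by \<open>\<gamma>\<close> gains more than the noise can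
  lose.\<close>

lemma contracted_le_minus_eta:
  assumes "d \<ge> K - c"
  shows "\<gamma> * d + l \<le> d - \<eta>"
proof -
  have "(1 - \<gamma>) * (K - c) \<le> (1 - \<gamma>) * d"
    using assms gamma_bounds by (intro mult_left_mono) auto
  moreover have "\<eta> \<le> (1 - \<gamma>) * (K - c) - l" by (simp add: \<eta>_def)
  ultimately show ?thesis by (simp add: algebra_simps)
qed

lemma step_approaches:
  assumes "x \<ge> 0" "\<bar>x - K\<bar> \<ge> K - c" "1 / 2 \<le> w" "w \<le> 1"
  shows "\<bar>step x w - K\<bar> \<le> \<bar>x - K\<bar> - \<eta>"
proof (cases "x \<ge> c")
  case True
  then have "\<bar>step x w - K\<bar> \<le> \<gamma> * \<bar>x - K\<bar> + l"
    using assms by (intro step_contracts) auto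
  also have "\<dots> \<le> \<bar>x - K\<bar> - \<eta>"
    using contracted_le_minus_eta assms(2) .
  finally show ?thesis .
next
  case False
  then have x: "x < c" by simp
  have "l * (1 / 2) \<le> l * w" "l * w \<le> l * 1"
    using assms l_pos by (auto intro: mult_left_mono)
  moreover have "\<gamma> * (K - x) + l \<le> K - x - \<eta>"
    using contracted_le_minus_eta[of "K - x"] x by simp
  moreover have "\<eta> \<le> l / 2" unfolding \<eta>_def by (rule min.cobounded2)
  ultimately have "\<bar>control x + l * w - K\<bar> \<le> K - x - \<eta>"
    using control_left[OF assms(1) x] by linarith
  then show ?thesis using step_dist_le[of x w] x c_bounds by simp
qed

lemma step_dist_bounded:
  assumes "x \<ge> 0" "\<bar>w\<bar> \<le> 1"
  shows "\<bar>step x w - K\<bar> \<le> max \<bar>x - K\<bar> K"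
proof (cases "\<bar>x - K\<bar> \<le> K - c")
  case True
  then show ?thesis using step_stays_trapped[OF True assms(2)] c_bounds by simp
next
  case far: False
  show ?thesis
  proof (cases "x \<ge> c")
    case True
    then show ?thesis
      using step_contracts[OF True assms(2)] contracted_le_minus_eta[of "\<bar>x - K\<bar>"] far eta_pos
      by linarith
  next
    case False
    then have "control x - K + l * w \<le> \<gamma> * (K - x) + l"
      using control_left(2)[OF assms(1)] noise_le[OF assms(2)] by linarith
    also have "\<dots> \<le> K"
      using contracted_le_minus_eta[of "K - x"] False eta_pos assms by simp
    finally have "step x w - K \<le> K" using c_bounds by (simp add: step_def)
    then show ?thesis using step_nonneg[of x w] by linarith
  qed
qed

end

section \<open>Orbits along a fixed noise sequence\<close>

locale perturbed_orbit = perturbed_map +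
  fixes y z :: "nat \<Rightarrow> real"
  assumes y_0: "y 0 \<ge> 0"
    and y_Suc: "\<And>n. y (Suc n) = step (y n) (z (Suc n))"
    and z_bound: "\<And>n. \<bar>z (Suc n)\<bar> \<le> 1"
begin

lemma y_nonneg: "y n \<ge> 0"
  by (cases n) (simp_all add: y_0 y_Suc step_nonneg)

lemma y_dist_bounded: "\<bar>y n - K\<bar> \<le> max \<bar>y 0 - K\<bar> K"
proof (induction n)
  case (Suc n)
  then show ?case
    using step_dist_bounded[OF y_nonneg[of n] z_bound[of n]] y_Suc[of n] by simp
qed simp

lemma trapped_forever:
  assumes "\<bar>y m - K\<bar> \<le> K - c"
  shows "\<bar>y (m + k) - K\<bar> \<le> K - c"
  by (induction k) (simp_all add: assms y_Suc step_stays_trapped z_bound)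

text \<open>Iterating \<open>d \<mapsto> \<gamma> * d + l\<close>, whose fixed point is \<open>l / (1 - \<gamma>)\<close>.\<close>

lemma trapped_dist_le:
  assumes "\<bar>y m - K\<bar> \<le> K - c"
  shows "\<bar>y (m + k) - K\<bar> \<le> \<gamma> ^ k * (K - c) + l / (1 - \<gamma>)"
proof (induction k)
  case 0
  have "0 \<le> l / (1 - \<gamma>)" using l_pos gamma_bounds by simp
  then show ?case using assms by simp
next
  case (Suc k)
  have "\<bar>y (m + k) - K\<bar> \<le> K - c" using trapped_forever[OF assms] .
  then have "\<bar>y (m + Suc k) - K\<bar> \<le> \<gamma> * \<bar>y (m + k) - K\<bar> + l"
    using z_bound by (simp add: y_Suc step_contracts)
  also have "\<gamma> * \<bar>y (m + k) - K\<bar> \<le> \<gamma> * (\<gamma> ^ k * (K - c) + l / (1 - \<gamma>))"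
    using Suc gamma_bounds by (intro mult_left_mono) auto
  also have "\<gamma> * (\<gamma> ^ k * (K - c) + l / (1 - \<gamma>)) + l = \<gamma> ^ Suc k * (K - c) + l / (1 - \<gamma>)"
    using gamma_bounds by (simp add: field_simps)
  finally show ?case by simp
qed

lemma eventually_near_if_trapped:
  assumes "\<bar>y m - K\<bar> \<le> K - c" "\<epsilon> > 0"
  shows "\<exists>N0. \<forall>n\<ge>N0. \<bar>y n - K\<bar> < l / (1 - \<gamma>) + \<epsilon>"
proof -
  have "(\<lambda>k. \<gamma> ^ k * (K - c)) \<longlonglongrightarrow> 0"
    using gamma_bounds by (intro tendsto_mult_left_zero LIMSEQ_power_zero) simp
  then have "\<forall>\<^sub>F k in sequentially. \<gamma> ^ k * (K - c) < \<epsilon>"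
    using assms(2) by (rule order_tendstoD(2))
  then obtain k0 where k0: "\<And>k. k \<ge> k0 \<Longrightarrow> \<gamma> ^ k * (K - c) < \<epsilon>"
    by (auto simp: eventually_sequentially)
  have "\<bar>y n - K\<bar> < l / (1 - \<gamma>) + \<epsilon>" if "n \<ge> m + k0" for n
  proof -
    have "k0 \<le> n - m" "m + (n - m) = n" using that by auto
    then show ?thesis using trapped_dist_le[OF assms(1), of "n - m"] k0[of "n - m"] by simp
  qed
  then show ?thesis by blast
qed

text \<open>While the trap is not reached, each noise value \<open>\<ge> 1/2\<close> costs the distance \<open>\<eta>\<close>, and
  the distance starts from at most \<open>max \<bar>y 0 - K\<bar> K\<close>.\<close>

lemma trapped_after_run:
  assumes run: "\<And>i. i \<in> {m<..m + N} \<Longrightarrow> z i \<ge> 1 / 2"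
    and N: "real N * \<eta> > max \<bar>y 0 - K\<bar> K"
  shows "\<exists>k. \<bar>y k - K\<bar> \<le> K - c"
proof (rule ccontr)
  assume "\<not> ?thesis"
  then have far: "\<bar>y k - K\<bar> > K - c" for k by (simp add: not_le)
  have "\<bar>y (m + j) - K\<bar> \<le> max \<bar>y 0 - K\<bar> K - real j * \<eta>" if "j \<le> N" for j
    using that
  proof (induction j)
    case 0
    then show ?case using y_dist_bounded[of m] by simp
  next
    case (Suc j)
    have "z (Suc (m + j)) \<ge> 1 / 2" using run Suc.prems by simp
    then have "\<bar>y (m + Suc j) - K\<bar> \<le> \<bar>y (m + j) - K\<bar> - \<eta>"
      using step_approaches[OF y_nonneg[of "m + j"] less_imp_le[OF far]] z_bound[of "m + j"]
      by (simp add: y_Suc)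
    then show ?case using Suc by (simp add: algebra_simps)
  qed
  from this[of N] N show False by linarith
qed

end

section \<open>Runs in an independent identically distributed sequence\<close>

text \<open>Runs of length \<open>N\<close> at disjoint blocks of indices are independent events of equal
  probability \<open>q ^ N > 0\<close>, so the probability that none of the first \<open>m\<close> blocks is a run tends to
  zero with \<open>m\<close>.\<close>

lemma (in prob_space) AE_run_in_set:
  fixes X :: "nat \<Rightarrow> 'a \<Rightarrow> real"
  assumes indep: "indep_vars (\<lambda>_. borel) X {1..}"
    and S: "S \<in> sets borel"
    and q: "\<And>n. n \<ge> 1 \<Longrightarrow> prob {\<omega> \<in> space M. X n \<omega> \<in> S} = q" "q > 0"
  shows "AE \<omega> in M. \<exists>m. \<forall>i\<in>{m<..m + N}. X i \<omega> \<in> S"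
proof (cases "N = 0")
  case True
  then show ?thesis by simp
next
  case False
  define I where "I j = {j * N<..j * N + N}" for j
  have I: "finite (I j)" "I j \<noteq> {}" "card (I j) = N" "I j \<subseteq> {1..}" for j
    using False by (auto simp: I_def)
  define run where "run j = {\<omega> \<in> space M. \<forall>i\<in>I j. X i \<omega> \<in> S}" for j
  have X[measurable]: "X i \<in> borel_measurable M" if "i \<ge> 1" for i
    using indep that by (auto simp: indep_vars_def)
  have run_sets: "run j \<in> events" for j
  proof -
    have "run j = (\<Inter>i\<in>I j. X i -` S \<inter> space M)" using I[of j] by (auto simp: run_def)
    also have "\<dots> \<in> events"
    proof (intro sets.finite_INT I)
      fix i assume "i \<in> I j"
      then have "X i \<in> borel_measurable M" using I(4)[of j] by (intro X) auto
      then show "X i -` S \<inter> space M \<in> events" using S by (rule measurable_sets)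
    qed
    finally show ?thesis .
  qed
  have hits: "indep_events (\<lambda>i. {\<omega> \<in> space M. X i \<omega> \<in> S}) {1..}"
    using S by (intro indep_eventsI_indep_vars[OF indep]) simp
  have prob_run: "prob (run j) = q ^ N" for j
  proof -
    have "run j = (\<Inter>i\<in>I j. {\<omega> \<in> space M. X i \<omega> \<in> S})" using I[of j] by (auto simp: run_def)
    also have "prob \<dots> = (\<Prod>i\<in>I j. prob {\<omega> \<in> space M. X i \<omega> \<in> S})"
      using hits I[of j] unfolding indep_events_def by blast
    also have "\<dots> = (\<Prod>i\<in>I j. q)" using I(4)[of j] by (intro prod.cong q(1)) auto
    finally show ?thesis using I[of j] by simp
  qed
  have disj: "disjoint_family_on I UNIV"
  proof -
    have aux: "I a \<inter> I b = {}" if "a < b" for a b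
    proof -
      have "Suc a * N \<le> b * N" using that by (intro mult_right_mono) auto
      then show ?thesis by (auto simp: I_def)
    qed
    show ?thesis unfolding disjoint_family_on_def
      using aux by (metis Int_commute linorder_neqE_nat)
  qed
  have blocks: "indep_vars (\<lambda>j. PiM (I j) (\<lambda>_. borel)) (\<lambda>j \<omega>. restrict (\<lambda>i. X i \<omega>) (I j)) UNIV"
    using I(4) disj by (intro indep_vars_restrict[OF indep]) auto
  have "indep_events (\<lambda>j. {\<omega> \<in> space M. \<not> (\<forall>i\<in>I j. restrict (\<lambda>i. X i \<omega>) (I j) i \<in> S)}) UNIV"
  proof (rule indep_eventsI_indep_vars[OF blocks])
    fix j :: nat
    have "{h \<in> space (PiM (I j) (\<lambda>_. borel)). \<forall>i\<in>I j. h i \<in> S} = Pi\<^sub>E (I j) (\<lambda>_. S)"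
      by (auto simp: space_PiM PiE_def)
    also have "\<dots> \<in> sets (PiM (I j) (\<lambda>_. borel :: real measure))"
      using I(1) S by (intro sets_PiM_I_finite) auto
    finally show "{h \<in> space (PiM (I j) (\<lambda>_. borel)). \<not> (\<forall>i\<in>I j. h i \<in> S)}
        \<in> sets (PiM (I j) (\<lambda>_. borel :: real measure))"
      by (rule sets.sets_Collect_neg)
  qed
  also have "(\<lambda>j. {\<omega> \<in> space M. \<not> (\<forall>i\<in>I j. restrict (\<lambda>i. X i \<omega>) (I j) i \<in> S)})
      = (\<lambda>j. space M - run j)"
    by (auto simp: run_def fun_eq_iff)
  finally have fails: "indep_events (\<lambda>j. space M - run j) UNIV" .
  have prob_fails: "prob (\<Inter>j\<in>{..m}. space M - run j) = (1 - q ^ N) ^ Suc m" for m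
  proof -
    have "prob (\<Inter>j\<in>{..m}. space M - run j) = (\<Prod>j\<in>{..m}. prob (space M - run j))"
      using fails unfolding indep_events_def by blast
    also have "\<dots> = (\<Prod>j\<in>{..m}. 1 - q ^ N)"
      using prob_compl[OF run_sets] prob_run by simp
    finally show ?thesis by simp
  qed
  define bad where "bad = (\<Inter>j. space M - run j)"
  have bad_sets: "bad \<in> events" unfolding bad_def using run_sets by auto
  have "(\<lambda>m. (1 - q ^ N) ^ Suc m) \<longlonglongrightarrow> 0"
  proof (rule LIMSEQ_Suc[OF LIMSEQ_power_zero])
    have "q ^ N \<le> 1" using prob_run[of 0] prob_le_1[of "run 0"] by simp
    moreover have "q ^ N > 0" using q(2) by simp
    ultimately show "norm (1 - q ^ N) < 1" by simp
  qed
  moreover have "prob bad \<le> (1 - q ^ N) ^ Suc m" for m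
  proof -
    have "prob bad \<le> prob (\<Inter>j\<in>{..m}. space M - run j)"
      unfolding bad_def using run_sets by (intro finite_measure_mono sets.finite_INT) auto
    then show ?thesis by (simp only: prob_fails)
  qed
  ultimately have "prob bad \<le> 0"
    by (intro LIMSEQ_le_const) auto
  then have "bad \<in> null_sets M"
    using bad_sets measure_nonneg[of M bad] by (simp add: null_sets_def emeasure_eq_measure)
  then show ?thesis
  proof (rule AE_I')
    show "{\<omega> \<in> space M. \<not> (\<exists>m. \<forall>i\<in>{m<..m + N}. X i \<omega> \<in> S)} \<subseteq> bad"
      by (auto simp: bad_def run_def I_def)
  qed
qed

lemma (in assumption_N) prob_interval:
  assumes "n \<ge> 1" "-1 \<le> a" "a < b" "b \<le> \<nu>"
  shows "prob {\<omega> \<in> space P. \<xi> n \<omega> \<in> {a..b}} = prob {\<omega> \<in> space P. \<xi> 1 \<omega> \<in> {a..b}}"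
    and "prob {\<omega> \<in> space P. \<xi> n \<omega> \<in> {a..b}} > 0"
proof -
  have meas: "\<xi> k \<in> borel_measurable P" if "k \<ge> 1" for k
    using common_density[OF that] by (simp add: distributed_def)
  have law: "measure (distr P borel (\<xi> k)) {a..b} = prob {\<omega> \<in> space P. \<xi> k \<omega> \<in> {a..b}}"
    if "k \<ge> 1" for k
    using measure_distr[OF meas[OF that], of "{a..b}"] by (simp add: vimage_def Int_def conj_commute)
  have "distr P borel (\<xi> k) = density lborel (\<lambda>t. ennreal (\<phi> t))" if "k \<ge> 1" for k
    using distributed_distr_eq_density[OF common_density[OF that]]
    by (simp cong: distr_cong)
  then show "prob {\<omega> \<in> space P. \<xi> n \<omega> \<in> {a..b}} = prob {\<omega> \<in> space P. \<xi> 1 \<omega> \<in> {a..b}}"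
    using law[of n] law[of 1] assms(1) by simp
  have "measure (distr P borel (\<xi> n)) {a..b} > 0"
  proof (intro interval_pos)
    show "\<exists>s\<in>{a..b}. \<exists>t\<in>{a..b}. s < t" using assms by (intro bexI[of _ a] bexI[of _ b]) auto
  qed (use assms in \<open>auto simp: is_interval_cc\<close>)
  then show "prob {\<omega> \<in> space P. \<xi> n \<omega> \<in> {a..b}} > 0"
    using law[OF assms(1)] by simp
qed

section \<open>Almost sure attraction\<close>

text \<open>The event on which the orbit is attracted is known only to contain an event of probability
  one; completeness of the measure makes it measurable.\<close>

lemma (in prob_space) prob_Collect_eq_1_if_complete:
  assumes "complete_measure M" "AE \<omega> in M. Q \<omega>"
  shows "prob {\<omega> \<in> space M. Q \<omega>} = 1"
proof -
  interpret complete_measure M by fact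
  obtain N where N: "{\<omega> \<in> space M. \<not> Q \<omega>} \<subseteq> N" "N \<in> null_sets M"
    using assms(2) by (auto elim!: AE_E simp: null_sets_def)
  then have "{\<omega> \<in> space M. \<not> Q \<omega>} \<in> events"
    using complete by blast
  then have "space M - {\<omega> \<in> space M. \<not> Q \<omega>} \<in> events" by blast
  also have "space M - {\<omega> \<in> space M. \<not> Q \<omega>} = {\<omega> \<in> space M. Q \<omega>}" by blast
  finally show ?thesis using assms(2) prob_Collect_eq_1 by blast
qed

theorem lemma4p1:
  fixes f :: "real \<Rightarrow> real"
    and K M c \<alpha> \<gamma> l x0 \<epsilon> :: real
    and P :: "'a measure"
    and F :: "nat \<Rightarrow> 'a measure"
    and \<xi> :: "nat \<Rightarrow> 'a \<Rightarrow> real"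
    and \<phi> :: "real \<Rightarrow> real"
    and x :: "nat \<Rightarrow> 'a \<Rightarrow> real"
  assumes "K > 0"
    and "assumption_A f K M"
    and "assumption_B f K c"
    and "assumption_N P F \<xi> \<phi> 1"
    and "\<alpha> \<in> {1 - 1 / M <..< 1}"
    and "\<gamma> = max \<alpha> (1 - \<alpha>)"
    and "l > 0"
    and "l < (1 - \<gamma>) * (K - c)"
    and "x0 > 0"
    and "\<And>\<omega>. \<omega> \<in> space P \<Longrightarrow> x 0 \<omega> = x0"
    and "\<And>n \<omega>. \<omega> \<in> space P \<Longrightarrow>
           x (Suc n) \<omega> = max (f (x n \<omega>) - \<alpha> * (f (x n \<omega>) - x n \<omega>) + l * \<xi> (Suc n) \<omega>) 0"
    and "\<epsilon> > 0"
  shows "measure P {\<omega> \<in> space P. \<exists>N0. \<forall>n\<ge>N0.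
           x n \<omega> \<in> {K - l / (1 - \<gamma>) - \<epsilon> <..< K + l / (1 - \<gamma>) + \<epsilon>}} = 1"
proof -
  interpret noise: assumption_N P F \<xi> \<phi> 1 by fact
  interpret perturbed_map f K M c \<alpha> \<gamma> l using assms by unfold_locales
  obtain N :: nat where N: "real N * \<eta> > max \<bar>x0 - K\<bar> K"
    using reals_Archimedean3[OF eta_pos] by blast
  define q where "q = noise.prob {\<omega> \<in> space P. \<xi> 1 \<omega> \<in> {1 / 2..1}}"
  have "AE \<omega> in P. \<exists>m. \<forall>i\<in>{m<..m + N}. \<xi> i \<omega> \<in> {1 / 2..1}"
  proof (rule noise.AE_run_in_set[OF noise.indep])
    show "q > 0" unfolding q_def by (rule noise.prob_interval(2)) auto
    show "noise.prob {\<omega> \<in> space P. \<xi> n \<omega> \<in> {1 / 2..1}} = q" if "n \<ge> 1" for n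
      unfolding q_def using that by (intro noise.prob_interval(1)) auto
  qed simp
  then have "AE \<omega> in P. \<exists>N0. \<forall>n\<ge>N0.
      x n \<omega> \<in> {K - l / (1 - \<gamma>) - \<epsilon> <..< K + l / (1 - \<gamma>) + \<epsilon>}"
  proof (rule AE_mp, intro AE_I2 impI)
    fix \<omega> assume \<omega>: "\<omega> \<in> space P"
      and "\<exists>m. \<forall>i\<in>{m<..m + N}. \<xi> i \<omega> \<in> {1 / 2..1}"
    then obtain m where run: "\<And>i. i \<in> {m<..m + N} \<Longrightarrow> \<xi> i \<omega> \<ge> 1 / 2" by fastforce
    interpret perturbed_orbit f K M c \<alpha> \<gamma> l "\<lambda>n. x n \<omega>" "\<lambda>n. \<xi> n \<omega>"
    proof
      show "x 0 \<omega> \<ge> 0" using assms(9,10) \<omega> by simp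
      show "x (Suc n) \<omega> = step (x n \<omega>) (\<xi> (Suc n) \<omega>)" for n
        using assms(11)[OF \<omega>] by (simp add: step_def control_def)
      show "\<bar>\<xi> (Suc n) \<omega>\<bar> \<le> 1" for n
        using noise.range[OF _ \<omega>, of "Suc n"] by (simp add: abs_le_iff)
    qed
    have "real N * \<eta> > max \<bar>x 0 \<omega> - K\<bar> K" using N assms(10)[OF \<omega>] by simp
    from trapped_after_run[OF run this]
    obtain k where "\<bar>x k \<omega> - K\<bar> \<le> K - c" by blast
    from eventually_near_if_trapped[OF this \<open>\<epsilon> > 0\<close>]
    obtain N0 where "\<And>n. n \<ge> N0 \<Longrightarrow> \<bar>x n \<omega> - K\<bar> < l / (1 - \<gamma>) + \<epsilon>" by blast
    then have "x n \<omega> \<in> {K - l / (1 - \<gamma>) - \<epsilon> <..< K + l / (1 - \<gamma>) + \<epsilon>}" if "n \<ge> N0" for n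
      using that by (fastforce simp: abs_less_iff)
    then show "\<exists>N0. \<forall>n\<ge>N0. x n \<omega> \<in> {K - l / (1 - \<gamma>) - \<epsilon> <..< K + l / (1 - \<gamma>) + \<epsilon>}"
      by blast
  qed
  then show ?thesis
    by (intro noise.prob_Collect_eq_1_if_complete noise.complete_measure_axioms)
qed

end
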